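(* Let $V$ be a two-Higgs-doublet potential with parameters $M^\mu$, $\Lambda^{\mu\nu}$ satisfying the positivity constraint, and suppose that there exists one and only one (up to scaling) eigenvector of the $3\times3$ matrix $(\Lambda_{ij})_{i,j=1,2,3}$ orthogonal both to $(\Lambda_{0i})_{i=1,2,3}$ and to $(M_i)_{i=1,2,3}$. Let $\Lambda^{\mu\nu}=\mathrm{diag}(\Lambda_0,-\Lambda_1,-\Lambda_2,-\Lambda_3)$ be the quartic tensor of the prototypical model, with the second axis along that eigenvector. Then a spontaneously $CP$-violating stationary point of $V$ can be a minimum only if $\Lambda_2$ is the largest spacelike eigenvalue of $\Lambda^{\mu\nu}$, i.e. $\Lambda_2>\Lambda_1$ and $\Lambda_2>\Lambda_3$.
   Context: Two Higgs doublets $\phi_1,\phi_2\in\mathbb{C}^2$ are given, and the general potential is $V=-M_\mu r^\mu+\frac12\Lambda_{\mu\nu}r^\mu r^\nu$ (sum over repeated indices $0,\dots,3$), with a real four-vector $M^\mu$ and a real symmetric tensor $\Lambda^{\mu\nu}$, where $r^0=\phi_1^\dagger\phi_1+\phi_2^\dagger\phi_2$, $r^1=2\,\mathrm{Re}(\phi_1^\dagger\phi_2)$, $r^2=2\,\mathrm{Im}(\phi_1^\dagger\phi_2)$, $r^3=\phi_1^\dagger\phi_1-\phi_2^\dagger\phi_2$. Indices are raised and lowered with $g=\mathrm{diag}(1,-1,-1,-1)$. Positivity constraint (standing assumption): $\Lambda_{\mu\nu}r^\mu r^\nu>0$ for every nonzero $r$ with $r^0\ge0$, $r^\mu r_\mu\ge0$.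 Orthogonality of 3-vectors is Euclidean. A reparametrization $\phi_i\mapsto\sum_jU_{ij}\phi_j$ with $U\in SU(2)$ induces an $SO(3)$ rotation of $(r^1,r^2,r^3)$, and with $U\in SL(2,\mathbb{C})$ a proper orthochronous Lorentz transformation $L$ of $r^\mu$; the parameters transform as $M\mapsto LM$, $\Lambda\mapsto L\Lambda L^T$ (upper-index components). Written as a polynomial in the products $\phi_i^\dagger\phi_j$, the potential has all coefficients real in a given basis exactly when $M_2=\Lambda_{02}=\Lambda_{12}=\Lambda_{23}=0$ in that basis. $V$ is explicitly $CP$-conserving if some $SU(2)$ reparametrization makes all its coefficients real; this holds if and only if some eigenvector of $(\Lambda_{ij})$ is orthogonal to both $(\Lambda_{0i})$ and $(M_i)$. Prototypical model: first rotate by $SU(2)$ so that the distinguished eigenvector of $(\Lambda_{ij})$ points along the second axis (the potential is then real). Then apply a proper orthochronous Lorentz transformation acting only on the coordinates $0,1,3$ that brings $\Lambda^{\mu\nu}$ to the form $\mathrm{diag}(\Lambda_0,-\Lambda_1,-\Lambda_2,-\Lambda_3)$; by the positivity constraint this is possible, and $\Lambda_0>0$, $\Lambda_0>\Lambda_1,\Lambda_2,\Lambda_3$. The numbers $\Lambda_1,\Lambda_2,\Lambda_3$ are the spacelike eigenvalues. A neutral stationary point is a configuration $(\phi_1,\phi_2)\neq(0,0)$ with $\phi_1,\phi_2$ proportional at which the gradient of $V$ with respect to the eight real fields vanishes. For an explicitly $CP$-conserving $V$, it is spontaneously $CP$-violating if there is no $SU(2)$ reparametrization after which simultaneously all coefficients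 of the potential are real and the two doublets at that point have no relative phase, i.e. $\mathrm{Im}(\phi_1^\dagger\phi_2)=0$. $V$ is invariant under the electroweak group $U(2)$ acting simultaneously by $\phi_i\mapsto U\phi_i$, $i=1,2$. A stationary point is called a minimum if all Hessian eigenvalues other than those of the Goldstone modes are strictly positive, i.e. the $8\times 8$ Hessian is positive semidefinite with kernel exactly the tangent space of the electroweak orbit. *)

theory Defs
  imports "HOL-Analysis.Analysis"
begin

text \<open>
  Four-vectors have index type \<open>4\<close>, whose elements are \<open>0, 1, 2, 3\<close>; component \<open>0\<close> is the time
  component.  All vectors and matrices over this type hold upper-index components, unless they
  are produced by \<open>lower_vec\<close> or \<open>lower_tensor\<close>.
\<close>

definition diag4 :: "real \<Rightarrow> real \<Rightarrow> real \<Rightarrow> real \<Rightarrow> real^4^4" where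
  "diag4 a b c d =
    (\<chi> i j. if i = j then (if i = 0 then a else if i = 1 then b else if i = 2 then c else d) else 0)"

definition minkowski :: "real^4^4" where
  "minkowski = diag4 1 (-1) (-1) (-1)"

definition lower_vec :: "real^4 \<Rightarrow> real^4" where
  "lower_vec M = minkowski *v M"

definition lower_tensor :: "real^4^4 \<Rightarrow> real^4^4" where
  "lower_tensor \<Lambda> = minkowski ** \<Lambda> ** minkowski"


subsection \<open>Fields and potential\<close>

text \<open>
  A configuration \<open>\<Phi>\<close> is a pair of doublets, \<open>\<Phi> $ 1\<close> and \<open>\<Phi> $ 2\<close>, each a vector in \<open>complex^2\<close>.
  As a real Euclidean space the type has dimension 8.
\<close>

type_synonym config = "complex^2^2"

definition herm :: "complex^2 \<Rightarrow> complex^2 \<Rightarrow> complex" where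
  "herm x y = (\<Sum>a\<in>UNIV. cnj (x $ a) * y $ a)"

definition rvec :: "config \<Rightarrow> real^4" where
  "rvec \<Phi> = (\<chi> \<mu>.
     if \<mu> = 0 then Re (herm (\<Phi> $ 1) (\<Phi> $ 1)) + Re (herm (\<Phi> $ 2) (\<Phi> $ 2))
     else if \<mu> = 1 then 2 * Re (herm (\<Phi> $ 1) (\<Phi> $ 2))
     else if \<mu> = 2 then 2 * Im (herm (\<Phi> $ 1) (\<Phi> $ 2))
     else Re (herm (\<Phi> $ 1) (\<Phi> $ 1)) - Re (herm (\<Phi> $ 2) (\<Phi> $ 2)))"

definition potential :: "real^4 \<Rightarrow> real^4^4 \<Rightarrow> config \<Rightarrow> real" where
  "potential M \<Lambda> \<Phi> =
     - (lower_vec M \<bullet> rvec \<Phi>) + 1/2 * (rvec \<Phi> \<bullet> (lower_tensor \<Lambda> *v rvec \<Phi>))"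

definition positivity :: "real^4^4 \<Rightarrow> bool" where
  "positivity \<Lambda> \<longleftrightarrow>
     (\<forall>r. r \<noteq> 0 \<and> r $ 0 \<ge> 0 \<and> r \<bullet> lower_vec r \<ge> 0 \<longrightarrow> r \<bullet> (lower_tensor \<Lambda> *v r) > 0)"


subsection \<open>Reparametrizations\<close>

definition dagger :: "complex^2^2 \<Rightarrow> complex^2^2" where
  "dagger A = (\<chi> i j. cnj (A $ j $ i))"

definition U2 :: "(complex^2^2) set" where
  "U2 = {U. dagger U ** U = mat 1}"

definition SU2 :: "(complex^2^2) set" where
  "SU2 = {U \<in> U2. det U = 1}"

text \<open>
  Row \<open>i\<close> of \<open>U ** \<Phi>\<close> is the doublet \<open>\<Sum>\<^sub>j U\<^sub>i\<^sub>j \<phi>\<^sub>j\<close>.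
  The matrix \<open>L\<close> below is unique, since the vectors \<open>rvec \<Phi>\<close> span the whole space.
\<close>

definition reparam :: "complex^2^2 \<Rightarrow> config \<Rightarrow> config" where
  "reparam U \<Phi> = U ** \<Phi>"

definition induces :: "complex^2^2 \<Rightarrow> real^4^4 \<Rightarrow> bool" where
  "induces U L \<longleftrightarrow> (\<forall>\<Phi>. rvec (reparam U \<Phi>) = L *v rvec \<Phi>)"

definition transform_tensor :: "real^4^4 \<Rightarrow> real^4^4 \<Rightarrow> real^4^4" where
  "transform_tensor L \<Lambda> = L ** \<Lambda> ** transpose L"

definition proper_orthochronous :: "real^4^4 \<Rightarrow> bool" where
  "proper_orthochronous L \<longleftrightarrow>
     transpose L ** minkowski ** L = minkowski \<and> det L = 1 \<and> L $ 0 $ 0 > 0"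

definition acts_only_on_013 :: "real^4^4 \<Rightarrow> bool" where
  "acts_only_on_013 L \<longleftrightarrow>
     (\<forall>\<mu>. L $ 2 $ \<mu> = (if \<mu> = 2 then 1 else 0) \<and> L $ \<mu> $ 2 = (if \<mu> = 2 then 1 else 0))"


subsection \<open>CP conservation and violation\<close>

text \<open>
  The coefficients of a polynomial in the four products \<open>\<phi>\<^sub>i\<^sup>\<dagger>\<phi>\<^sub>j\<close> are determined by the function,
  up to the symmetry \<open>c i j k l \<leftrightarrow> c k l i j\<close>, and symmetrization preserves reality.
\<close>

definition real_coefficients :: "(config \<Rightarrow> real) \<Rightarrow> bool" where
  "real_coefficients V \<longleftrightarrow>
     (\<exists>(b :: 2 \<Rightarrow> 2 \<Rightarrow> real) (c :: 2 \<Rightarrow> 2 \<Rightarrow> 2 \<Rightarrow> 2 \<Rightarrow> real). \<forall>\<Phi>.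
        complex_of_real (V \<Phi>) =
          (\<Sum>i\<in>UNIV. \<Sum>j\<in>UNIV. of_real (b i j) * herm (\<Phi> $ i) (\<Phi> $ j)) +
          (\<Sum>i\<in>UNIV. \<Sum>j\<in>UNIV. \<Sum>k\<in>UNIV. \<Sum>l\<in>UNIV.
             of_real (c i j k l) * (herm (\<Phi> $ i) (\<Phi> $ j) * herm (\<Phi> $ k) (\<Phi> $ l))))"

definition explicitly_CP_conserving :: "real^4 \<Rightarrow> real^4^4 \<Rightarrow> bool" where
  "explicitly_CP_conserving M \<Lambda> \<longleftrightarrow>
     (\<exists>U\<in>SU2. \<exists>L. induces U L \<and> real_coefficients (potential (L *v M) (transform_tensor L \<Lambda>)))"

definition stationary :: "(config \<Rightarrow> real) \<Rightarrow> config \<Rightarrow> bool" where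
  "stationary V \<Phi> \<longleftrightarrow> (V has_derivative (\<lambda>h. 0)) (at \<Phi>)"

definition neutral_stationary_point :: "(config \<Rightarrow> real) \<Rightarrow> config \<Rightarrow> bool" where
  "neutral_stationary_point V \<Phi> \<longleftrightarrow>
     \<Phi> \<noteq> 0 \<and>
     (\<exists>c d. (c, d) \<noteq> (0, 0) \<and> c *s (\<Phi> $ 1) + d *s (\<Phi> $ 2) = 0) \<and>
     stationary V \<Phi>"

definition spontaneously_CP_violating :: "real^4 \<Rightarrow> real^4^4 \<Rightarrow> config \<Rightarrow> bool" where
  "spontaneously_CP_violating M \<Lambda> \<Phi> \<longleftrightarrow>
     explicitly_CP_conserving M \<Lambda> \<and>
     neutral_stationary_point (potential M \<Lambda>) \<Phi> \<and>
     \<not> (\<exists>U\<in>SU2. \<exists>L. induces U L \<and>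
          real_coefficients (potential (L *v M) (transform_tensor L \<Lambda>)) \<and>
          Im (herm (reparam U \<Phi> $ 1) (reparam U \<Phi> $ 2)) = 0)"


subsection \<open>Minima\<close>

definition electroweak_orbit :: "config \<Rightarrow> config set" where
  "electroweak_orbit \<Phi> = {\<chi> i. W *v (\<Phi> $ i) | W. W \<in> U2}"

definition orbit_tangent_space :: "config \<Rightarrow> config set" where
  "orbit_tangent_space \<Phi> =
     {v. \<exists>\<gamma> :: real \<Rightarrow> config. \<gamma> 0 = \<Phi> \<and> (\<forall>t. \<gamma> t \<in> electroweak_orbit \<Phi>) \<and>
           (\<gamma> has_vector_derivative v) (at 0)}"

definition hessian :: "(config \<Rightarrow> real) \<Rightarrow> config \<Rightarrow> config \<Rightarrow> config \<Rightarrow> real" where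
  "hessian V \<Phi> h k = frechet_derivative (\<lambda>\<Psi>. frechet_derivative V (at \<Psi>) h) (at \<Phi>) k"

definition is_minimum :: "(config \<Rightarrow> real) \<Rightarrow> config \<Rightarrow> bool" where
  "is_minimum V \<Phi> \<longleftrightarrow>
     stationary V \<Phi> \<and>
     (\<forall>h. hessian V \<Phi> h h \<ge> 0) \<and>
     {h. \<forall>k. hessian V \<Phi> h k = 0} = orbit_tangent_space \<Phi>"


subsection \<open>The distinguished eigenvector and the prototypical model\<close>

text \<open>The three spatial indices of \<open>4\<close> (in the type \<open>3\<close>, the numerals \<open>3\<close> and \<open>0\<close> coincide).\<close>

definition spatial_index :: "3 \<Rightarrow> 4" where
  "spatial_index i = (if i = 1 then 1 else if i = 2 then 2 else 3)"

definition spatial_vec :: "real^4 \<Rightarrow> real^3" where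
  "spatial_vec x = (\<chi> i. x $ spatial_index i)"

definition spatial_block :: "real^4^4 \<Rightarrow> real^3^3" where
  "spatial_block A = (\<chi> i j. A $ spatial_index i $ spatial_index j)"

definition eigenvector :: "real^3^3 \<Rightarrow> real^3 \<Rightarrow> bool" where
  "eigenvector A e \<longleftrightarrow> e \<noteq> 0 \<and> (\<exists>l. A *v e = l *\<^sub>R e)"

definition CP_eigenvector :: "real^4 \<Rightarrow> real^4^4 \<Rightarrow> real^3 \<Rightarrow> bool" where
  "CP_eigenvector M \<Lambda> e \<longleftrightarrow>
     eigenvector (spatial_block (lower_tensor \<Lambda>)) e \<and>
     orthogonal e (spatial_vec (lower_tensor \<Lambda> $ 0)) \<and>
     orthogonal e (spatial_vec (lower_vec M))"

text \<open>
  \<open>R\<close> is the rotation that takes \<open>e\<close> to the second axis, and \<open>L\<close> the subsequent Lorentz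
  transformation of the coordinates \<open>0, 1, 3\<close> that diagonalizes the quartic tensor.
\<close>

definition prototypical_form ::
    "real^4^4 \<Rightarrow> real^3 \<Rightarrow> real \<Rightarrow> real \<Rightarrow> real \<Rightarrow> real \<Rightarrow> bool" where
  "prototypical_form \<Lambda> e \<Lambda>0 \<Lambda>1 \<Lambda>2 \<Lambda>3 \<longleftrightarrow>
     (\<exists>U\<in>SU2. \<exists>R L. induces U R \<and>
        (\<exists>s. spatial_block R *v e = s *\<^sub>R axis 2 1) \<and>
        proper_orthochronous L \<and> acts_only_on_013 L \<and>
        transform_tensor L (transform_tensor R \<Lambda>) = diag4 \<Lambda>0 (-\<Lambda>1) (-\<Lambda>2) (-\<Lambda>3))"

end

theory Submission imports Defs begin

text \<open>
  At a neutral point the vector \<open>r\<close> of bilinears is lightlike, and every vector Minkowski-orthogonal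
  to \<open>r\<close> is a first-order variation of \<open>r\<close> along neutral configurations.  Stationarity therefore
  forces the gradient of the potential in \<open>r\<close>-space to be \<open>k\<close> times the covector of \<open>r\<close>, and on a
  neutral variation \<open>\<delta>\<close> the Hessian is the quadratic form of \<open>\<Lambda> - k g\<close>.  In the
  prototypical frame \<open>M\<close> has no second component, while violation of \<open>CP\<close> means \<open>r\<^sup>2 \<noteq> 0\<close>; the second
  component of the stationarity condition then gives \<open>k = \<Lambda>\<^sub>2\<close>.  So the form is
  \<open>diag (\<Lambda>\<^sub>0 - \<Lambda>\<^sub>2, \<Lambda>\<^sub>2 - \<Lambda>\<^sub>1, 0, \<Lambda>\<^sub>2 - \<Lambda>\<^sub>3)\<close>, and since \<open>r\<^sup>2 \<noteq> 0\<close> the components 0, 1, 3 of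
  \<open>\<delta>\<close> are free.  A nonzero \<open>\<delta>\<close> is not a Goldstone direction, hence the form is strictly positive.
\<close>

subsection \<open>Minkowski geometry\<close>

definition mdot :: "real^4 \<Rightarrow> real^4 \<Rightarrow> real" where
  "mdot x y = x $ 0 * y $ 0 - x $ 1 * y $ 1 - x $ 2 * y $ 2 - x $ 3 * y $ 3"

text \<open>The library enumerates the index type as 1, 2, 3, 4; this identifies its last element
  with the time index.\<close>

lemma four_eq_zero: "(4::4) = 0"
  by simp

lemma forall_index4: "(\<forall>i::4. P i) \<longleftrightarrow> P 0 \<and> P 1 \<and> P 2 \<and> P 3"
  using forall_4[of P] by (auto simp: four_eq_zero)

lemma sum_index4: "(\<Sum>i\<in>(UNIV::4 set). f i) = f 0 + f 1 + f 2 + f 3"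
  for f :: "4 \<Rightarrow> 'a::comm_monoid_add"
  using sum_4[of f] by (simp add: four_eq_zero ac_simps)

declare transpose_matrix_vector [simp del]

lemma vec4_eq_iff:
  "x = y \<longleftrightarrow> x $ 0 = y $ 0 \<and> x $ 1 = y $ 1 \<and> x $ 2 = y $ 2 \<and> x $ 3 = y $ 3"
  for x y :: "'a^4"
  by (auto simp: vec_eq_iff forall_index4)

lemma inner_vec4: "x \<bullet> y = x $ 0 * y $ 0 + x $ 1 * y $ 1 + x $ 2 * y $ 2 + x $ 3 * y $ 3"
  for x y :: "real^4"
  by (simp add: inner_vec_def sum_index4)

lemma minkowski_mult_vec_nth: "(minkowski *v x) $ i = (if i = 0 then x $ 0 else - x $ i)"
  using exhaust_4[of i]
  by (auto simp: four_eq_zero minkowski_def diag4_def matrix_vector_mult_def sum_index4)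

lemma diag4_mult_vec_nth:
  "(diag4 a b c d *v x) $ 0 = a * x $ 0" "(diag4 a b c d *v x) $ 1 = b * x $ 1"
  "(diag4 a b c d *v x) $ 2 = c * x $ 2" "(diag4 a b c d *v x) $ 3 = d * x $ 3"
  by (simp_all add: diag4_def matrix_vector_mult_def sum_index4)

lemma minkowski_minkowski_vec: "minkowski *v (minkowski *v x) = x"
  by (simp add: vec4_eq_iff minkowski_mult_vec_nth)

lemma inner_minkowski: "x \<bullet> (minkowski *v y) = mdot x y"
  by (simp add: mdot_def inner_vec4 minkowski_mult_vec_nth)

lemma minkowski_inner: "(minkowski *v x) \<bullet> y = mdot x y"
  by (simp add: mdot_def inner_vec4 minkowski_mult_vec_nth)

lemma mdot_commute: "mdot x y = mdot y x"
  by (simp add: mdot_def)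

lemma mdot_add: "mdot (x + y) z = mdot x z + mdot y z" "mdot x (y + z) = mdot x y + mdot x z"
  by (simp_all add: mdot_def algebra_simps)

lemma transpose_minkowski: "transpose minkowski = minkowski"
  by (simp add: transpose_def minkowski_def diag4_def vec_eq_iff)

lemma inner_transpose_mult: "x \<bullet> (A *v y) = (transpose A *v x) \<bullet> y"
  for A :: "real^'n^'m"
  by (simp add: transpose_matrix_vector dot_lmul_matrix)

lemma lower_tensor_mult_vec: "lower_tensor \<Lambda> *v x = minkowski *v (\<Lambda> *v (minkowski *v x))"
  by (simp only: lower_tensor_def matrix_vector_mul_assoc matrix_mul_assoc)

lemma transform_tensor_mult_vec: "transform_tensor L \<Lambda> *v x = L *v (\<Lambda> *v (transpose L *v x))"
  by (simp only: transform_tensor_def matrix_vector_mul_assoc matrix_mul_assoc)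

section \<open>Lorentz transformations as isometries of the Minkowski product\<close>

definition lorentz :: "real^4^4 \<Rightarrow> bool" where
  "lorentz A \<longleftrightarrow> (\<forall>x y. mdot (A *v x) (A *v y) = mdot x y)"

lemma lorentz_iff: "lorentz A \<longleftrightarrow> transpose A ** minkowski ** A = minkowski"
proof -
  have "mdot (A *v x) (A *v y) = x \<bullet> ((transpose A ** minkowski ** A) *v y)" for x y
    by (simp add: inner_minkowski[symmetric] inner_transpose_mult[of x] matrix_vector_mul_assoc[symmetric])
  then have "lorentz A \<longleftrightarrow> (\<forall>x y. x \<bullet> ((transpose A ** minkowski ** A) *v y) = x \<bullet> (minkowski *v y))"
    by (simp add: lorentz_def inner_minkowski)
  also have "\<dots> \<longleftrightarrow> transpose A ** minkowski ** A = minkowski"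
    by (metis matrix_eq vector_eq_ldot)
  finally show ?thesis .
qed

lemma lorentz_mult: "lorentz A \<Longrightarrow> lorentz B \<Longrightarrow> lorentz (A ** B)"
  by (simp add: lorentz_def matrix_vector_mul_assoc[symmetric])

lemma lorentz_transpose_minkowski:
  assumes "lorentz A"
  shows "transpose A *v (minkowski *v (A *v x)) = minkowski *v x"
  using assms by (simp add: lorentz_iff matrix_vector_mul_assoc matrix_mul_assoc)

text \<open>The metric conjugate of the transpose is a left inverse, and for square matrices a left
  inverse is also a right inverse.\<close>

lemma lorentz_surj:
  assumes "lorentz A"
  obtains x where "A *v x = y"
proof -
  have "(minkowski ** transpose A ** minkowski) ** A = mat 1"
    unfolding matrix_eq
    by (simp add: matrix_vector_mul_assoc[symmetric] lorentz_transpose_minkowski[OF assms]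
        minkowski_minkowski_vec)
  then have "surj ((*v) A)"
    by (metis matrix_left_right_inverse matrix_right_invertible_surjective)
  then show thesis using that by (metis surjD)
qed

text \<open>With one index lowered the tensor is a linear map on upper-index vectors, and a Lorentz
  transformation acts on it by conjugation.\<close>

lemma transform_tensor_minkowski:
  assumes "lorentz A"
  shows "transform_tensor A \<Lambda> *v (minkowski *v (A *v x)) = A *v (\<Lambda> *v (minkowski *v x))"
  by (simp add: transform_tensor_mult_vec lorentz_transpose_minkowski[OF assms])

subsection \<open>The field bilinears\<close>

text \<open>Polarization of the quadratic map \<open>rvec\<close>, normalized to be its derivative;
  hence the factor 2 on the diagonal.\<close>

definition rform :: "config \<Rightarrow> config \<Rightarrow> real^4" where
  "rform \<Phi> h = (\<chi> \<mu>.
     if \<mu> = 0 then 2 * Re (herm (\<Phi> $ 1) (h $ 1)) + 2 * Re (herm (\<Phi> $ 2) (h $ 2))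
     else if \<mu> = 1 then 2 * Re (herm (\<Phi> $ 1) (h $ 2)) + 2 * Re (herm (h $ 1) (\<Phi> $ 2))
     else if \<mu> = 2 then 2 * Im (herm (\<Phi> $ 1) (h $ 2)) + 2 * Im (herm (h $ 1) (\<Phi> $ 2))
     else 2 * Re (herm (\<Phi> $ 1) (h $ 1)) - 2 * Re (herm (\<Phi> $ 2) (h $ 2)))"

lemma Re_herm: "Re (herm x y) = Re (x$1) * Re (y$1) + Im (x$1) * Im (y$1) + Re (x$2) * Re (y$2) + Im (x$2) * Im (y$2)"
  by (simp add: herm_def sum_2)

lemma Im_herm: "Im (herm x y) = Re (x$1) * Im (y$1) - Im (x$1) * Re (y$1) + Re (x$2) * Im (y$2) - Im (x$2) * Re (y$2)"
  by (simp add: herm_def sum_2)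

lemma rform_commute: "rform \<Phi> h = rform h \<Phi>"
  by (simp add: rform_def vec4_eq_iff Re_herm Im_herm)

lemma rform_self: "rform \<Phi> \<Phi> = 2 *\<^sub>R rvec \<Phi>"
  by (simp add: rform_def rvec_def vec4_eq_iff Re_herm Im_herm)

lemma bounded_bilinear_rform: "bounded_bilinear rform"
  unfolding bilinear_conv_bounded_bilinear[symmetric] bilinear_def
  by (auto intro!: linearI simp: rform_def vec4_eq_iff Re_herm Im_herm algebra_simps)

interpretation rform: bounded_bilinear rform
  by (rule bounded_bilinear_rform)

lemma rvec_eq_rform: "rvec \<Phi> = (1/2) *\<^sub>R rform \<Phi> \<Phi>"
  by (simp add: rform_self)

lemma rvec_has_derivative: "(rvec has_derivative rform \<Phi>) (at \<Phi>)"
proof -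
  have "((\<lambda>\<Phi>. (1/2) *\<^sub>R rform \<Phi> \<Phi>) has_derivative (\<lambda>h. (1/2) *\<^sub>R (rform \<Phi> h + rform h \<Phi>))) (at \<Phi>)"
    by (intro has_derivative_scaleR_right rform.FDERIV has_derivative_ident)
  moreover have "(1/2) *\<^sub>R (rform \<Phi> h + rform h \<Phi>) = rform \<Phi> h" for h
    by (simp only: rform_commute[of h]) (simp flip: scaleR_2)
  ultimately show ?thesis
    by (simp add: rvec_eq_rform[abs_def])
qed

text \<open>Both sides are four times the Gram determinant of the two doublets.\<close>

lemma mdot_rvec: "mdot (rvec \<Phi>) (rvec \<Phi>) = 4 * (cmod (det \<Phi>))\<^sup>2"
  unfolding cmod_power2
  by (simp add: mdot_def rvec_def Re_herm Im_herm det_2 power2_eq_square algebra_simps)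

text \<open>Such an \<open>x\<close> encodes a positive definite Hermitian Gram matrix, and
  \<open>\<Phi>\<close> is its triangular Cholesky factor.\<close>

lemma forward_cone_subset_range_rvec:
  assumes "mdot x x > 0" "x $ 0 > 0"
  obtains \<Phi> where "rvec \<Phi> = x"
proof -
  have *: "x$1^2 + x$2^2 + x$3^2 < x$0^2"
    using assms(1) by (simp add: mdot_def power2_eq_square)
  then have "\<bar>x$3\<bar>^2 < x$0^2"
    using zero_le_power2[of "x$1"] zero_le_power2[of "x$2"] by (simp only: power2_abs)
  then have pos: "x$0 + x$3 > 0"
    using assms(2) power2_less_imp_less[of "\<bar>x$3\<bar>" "x$0"] by linarith
  define a where "a = sqrt ((x$0 + x$3) / 2)"
  define c where "c = sqrt ((x$0 - x$3) / 2 - (x$1^2 + x$2^2) / (2 * (x$0 + x$3)))"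
  define \<Phi> :: config where "\<Phi> = vector [vector [of_real a, 0],
     vector [Complex (x$1 / (2*a)) (x$2 / (2*a)), of_real c]]"
  have a: "a^2 = (x$0 + x$3) / 2" "a > 0"
    using pos by (simp_all add: a_def)
  \<comment> \<open>The difference of the two sides is \<open>mdot x x / (2 * (x$0 + x$3))\<close>,
    so the radicand of \<open>c\<close> is nonnegative.\<close>
  have "(x$1^2 + x$2^2) / (2 * (x$0 + x$3)) \<le> (x$0 - x$3) / 2"
    using pos * by (simp add: divide_simps) (simp add: algebra_simps power2_eq_square)
  then have c: "c^2 = (x$0 - x$3) / 2 - (x$1^2 + x$2^2) / (2 * (x$0 + x$3))"
    by (simp add: c_def)
  have "(2*a)^2 = 2 * (x$0 + x$3)"
    by (simp add: power_mult_distrib a)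
  then have n: "(x$1 / (2*a))^2 + (x$2 / (2*a))^2 = (x$1^2 + x$2^2) / (2 * (x$0 + x$3))"
    by (simp only: power_divide add_divide_distrib)
  have "rvec \<Phi> $ 0 = a^2 + ((x$1 / (2*a))^2 + (x$2 / (2*a))^2) + c^2"
    "rvec \<Phi> $ 3 = a^2 - ((x$1 / (2*a))^2 + (x$2 / (2*a))^2) - c^2"
    by (simp_all add: rvec_def Re_herm Im_herm \<Phi>_def vector_def power2_eq_square)
  then have "rvec \<Phi> $ 0 = x $ 0" "rvec \<Phi> $ 3 = x $ 3"
    unfolding n a(1) c by (simp_all add: field_simps)
  moreover have "rvec \<Phi> $ 1 = x $ 1" "rvec \<Phi> $ 2 = x $ 2"
    using a(2) by (simp_all add: rvec_def Re_herm Im_herm \<Phi>_def vector_def)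
  ultimately show thesis
    by (intro that) (simp add: vec4_eq_iff)
qed


subsection \<open>Reparametrizations as Lorentz transformations\<close>

text \<open>A long enough shift along the time axis moves any vector into the open forward cone.
  Linear and quadratic identities known on the cone thereby extend to all vectors.\<close>

lemma forward_cone_translate:
  assumes "t \<ge> 1 + 3 * norm x"
  shows "mdot (x + t *\<^sub>R axis 0 1) (x + t *\<^sub>R axis 0 1) > 0" "(x + t *\<^sub>R axis 0 1) $ 0 > 0"
proof -
  let ?n = "norm x"
  have x0: "\<bar>x $ 0\<bar> \<le> ?n" by (rule component_le_norm_cart)
  have n: "x$0 * x$0 + x$1 * x$1 + x$2 * x$2 + x$3 * x$3 = ?n * ?n"
    using power2_norm_eq_inner[of x] by (simp add: inner_vec4 power2_eq_square)
  show "(x + t *\<^sub>R axis 0 1) $ 0 > 0"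
    using x0 assms by (simp add: axis_def)
  have "(t - 2 * ?n) * t \<ge> (1 + ?n) * (1 + 3 * ?n)"
    using assms norm_ge_zero[of x] by (intro mult_mono) linarith+
  then have "t * t - 2 * (t * ?n) \<ge> 1 + 4 * ?n + 3 * (?n * ?n)"
    by (simp add: algebra_simps)
  moreover have "t * (- x$0) \<le> t * ?n"
    using assms x0 by (intro mult_left_mono) (auto intro: order_trans[of 0 "1 + 3 * norm x" t])
  moreover have "mdot (x + t *\<^sub>R axis 0 1) (x + t *\<^sub>R axis 0 1)
      = t * t + 2 * (t * x$0) + 2 * (x$0 * x$0) - ?n * ?n"
    unfolding n[symmetric] by (simp add: mdot_def axis_def algebra_simps)
  moreover have "x$0 * x$0 \<ge> 0" "?n \<ge> 0" "?n * ?n \<ge> 0" by auto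
  ultimately show "mdot (x + t *\<^sub>R axis 0 1) (x + t *\<^sub>R axis 0 1) > 0"
    by linarith
qed

text \<open>Since \<open>det U = 1\<close>, the determinant formula for the Minkowski square shows
  that \<open>R\<close> preserves it on the forward cone. A quadratic form vanishing on an open cone
  vanishes identically.\<close>

lemma induces_lorentz:
  assumes "U \<in> SU2" "induces U R"
  shows "lorentz R"
proof -
  have cone: "mdot (R *v x) (R *v x) = mdot x x" if x: "mdot x x > 0" "x $ 0 > 0" for x
  proof -
    obtain \<Phi> where "rvec \<Phi> = x" using forward_cone_subset_range_rvec[OF x] .
    moreover have "R *v rvec \<Phi> = rvec (U ** \<Phi>)"
      using assms(2) by (simp add: induces_def reparam_def)
    moreover have "det (U ** \<Phi>) = det \<Phi>"
      using assms(1) by (simp add: SU2_def det_mul)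
    ultimately show ?thesis by (metis mdot_rvec)
  qed
  define B where "B x y = mdot (R *v x) (R *v y) - mdot x y" for x y
  let ?e = "axis 0 1 :: real^4"
  have B_add: "B (x + y) (x + y) = B x x + 2 * B x y + B y y" for x y
    by (simp add: B_def matrix_vector_right_distrib mdot_add mdot_commute[of "R *v y" "R *v x"]
        mdot_commute[of y x])
  have B_scale: "B x (t *\<^sub>R y) = t * B x y" "B (t *\<^sub>R x) y = t * B x y" for x y t
    by (simp_all add: B_def mdot_def matrix_vector_mult_scaleR algebra_simps)
  have "B ?e ?e = 0"
    using cone[of ?e] by (simp add: B_def mdot_def axis_def)
  \<comment> \<open>The defect \<open>B\<close> from being an isometry is affine in \<open>t\<close>
    along the time direction, so two admissible values of \<open>t\<close> determine both
    coefficients to be zero.\<close>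
  then have shift: "B x x + 2 * (t * B x ?e) = 0" if "t \<ge> 1 + 3 * norm x" for x t
    using cone[OF forward_cone_translate[OF that]] B_add[of x "t *\<^sub>R ?e"]
    by (simp add: B_scale) (simp add: B_def)
  have "B x x = 0" for x
  proof -
    define t where "t = 1 + 3 * norm x"
    have t: "B x x + 2 * (t * B x ?e) = 0" "B x x + 2 * ((t + 1) * B x ?e) = 0"
      by (rule shift; simp add: t_def)+
    have "2 * B x ?e = (B x x + 2 * ((t + 1) * B x ?e)) - (B x x + 2 * (t * B x ?e))"
      by (simp add: algebra_simps)
    then show ?thesis using t by simp
  qed
  then have "B x y = 0" for x y
    using B_add[of x y] by simp
  then show ?thesis by (simp add: lorentz_def B_def)
qed

lemma dagger_mult: "dagger (A ** B) = dagger B ** dagger A"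
  by (simp add: dagger_def matrix_matrix_mult_def vec_eq_iff mult.commute)

lemma rvec_0_eq_trace: "rvec \<Phi> $ 0 = Re ((dagger \<Phi> ** \<Phi>) $ 1 $ 1 + (dagger \<Phi> ** \<Phi>) $ 2 $ 2)"
  by (simp add: rvec_def Re_herm dagger_def matrix_matrix_mult_def sum_2)

text \<open>The time component is the trace of \<open>dagger \<Phi> ** \<Phi>\<close>, in which a
  unitary left factor cancels; linearity carries this beyond the cone.\<close>

lemma induces_U2_time_component:
  assumes "U \<in> U2" "induces U R"
  shows "(R *v x) $ 0 = x $ 0"
proof -
  have cone: "(R *v x) $ 0 = x $ 0" if x: "mdot x x > 0" "x $ 0 > 0" for x
  proof -
    obtain \<Phi> where \<Phi>: "rvec \<Phi> = x" using forward_cone_subset_range_rvec[OF x] .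
    have "dagger (U ** \<Phi>) ** (U ** \<Phi>) = dagger \<Phi> ** (dagger U ** U) ** \<Phi>"
      by (simp only: dagger_mult matrix_mul_assoc)
    then have "rvec (U ** \<Phi>) $ 0 = rvec \<Phi> $ 0"
      using assms(1) by (simp add: rvec_0_eq_trace U2_def)
    then show ?thesis
      using assms(2) \<Phi> by (auto simp: induces_def reparam_def)
  qed
  let ?e = "axis 0 1 :: real^4"
  let ?t = "1 + 3 * norm x"
  have "(R *v (x + ?t *\<^sub>R ?e)) $ 0 = (x + ?t *\<^sub>R ?e) $ 0"
    by (rule cone; rule forward_cone_translate; simp)
  moreover have "(R *v ?e) $ 0 = 1"
    using cone[of ?e] by (simp add: mdot_def axis_def)
  ultimately show ?thesis
    by (simp add: matrix_vector_right_distrib matrix_vector_mult_scaleR axis_def)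
qed

subsection \<open>Neutral directions and the electroweak orbit\<close>

lemma rform_collinear:
  fixes v z w :: "complex^2"
  defines "\<Phi> \<equiv> (\<chi> i. z $ i *s v)" and "h \<equiv> (\<chi> i. w $ i *s v)" and "n \<equiv> Re (herm v v)"
  shows "rform \<Phi> h $ 0 = 2 * n * Re (cnj (z$1) * w$1 + cnj (z$2) * w$2)"
    "rform \<Phi> h $ 1 = 2 * n * Re (cnj (z$1) * w$2 + cnj (w$1) * z$2)"
    "rform \<Phi> h $ 2 = 2 * n * Im (cnj (z$1) * w$2 + cnj (w$1) * z$2)"
    "rform \<Phi> h $ 3 = 2 * n * Re (cnj (z$1) * w$1 - cnj (z$2) * w$2)"
  by (simp_all add: \<Phi>_def h_def n_def rform_def Re_herm Im_herm algebra_simps)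

text \<open>All configurations \<open>\<Phi> + t *\<^sub>R h\<close> are neutral, so their bilinears
  are lightlike; the claim is the vanishing of the \<open>t^2\<close> coefficient of the Minkowski
  square.\<close>

lemma mdot_rform_collinear:
  fixes v z w :: "complex^2"
  defines "\<Phi> \<equiv> (\<chi> i. z $ i *s v)" and "h \<equiv> (\<chi> i. w $ i *s v)"
  shows "2 * mdot (rvec \<Phi>) (rvec h) = - mdot (rform \<Phi> h) (rform \<Phi> h)"
  unfolding \<Phi>_def h_def
  by (simp add: rvec_eq_rform mdot_def rform_collinear) (simp add: algebra_simps)

text \<open>Every tangent vector of the light cone at \<open>rvec \<Phi>\<close> comes from a
  variation along the common direction of the doublets. The second conclusion expresses the
  second-order change of the bilinears through \<open>\<delta>\<close> alone.\<close>

lemma rform_surj_neutral: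
  assumes "\<Phi> \<noteq> 0" and cd: "(c, d) \<noteq> (0, 0)" "c *s (\<Phi> $ 1) + d *s (\<Phi> $ 2) = 0"
    and \<delta>: "mdot (rvec \<Phi>) \<delta> = 0"
  obtains h where "rform \<Phi> h = \<delta>" "2 * mdot (rvec \<Phi>) (rvec h) = - mdot \<delta> \<delta>"
proof -
  have "\<exists>z v. \<Phi> = (\<chi> i. z $ i *s v) \<and> v \<noteq> 0 \<and> (z $ 1 = 1 \<or> z $ 2 = 1)"
  proof (cases "d = 0")
    case True
    then have "\<Phi> $ 1 = 0" using cd by (auto simp: vec_eq_iff)
    then have "\<Phi> = (\<chi> i. (vector [0, 1] :: complex^2) $ i *s \<Phi> $ 2)" "\<Phi> $ 2 \<noteq> 0"
      using \<open>\<Phi> \<noteq> 0\<close> by (auto simp: vec_eq_iff forall_2)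
    moreover have "(vector [0, 1] :: complex^2) $ 2 = 1" by simp
    ultimately show ?thesis by blast
  next
    case False
    have "\<Phi> $ 2 = (- c / d) *s \<Phi> $ 1"
      using cd(2) False by (simp add: vec_eq_iff field_simps add_eq_0_iff)
    then have "\<Phi> = (\<chi> i. (vector [1, - c / d] :: complex^2) $ i *s \<Phi> $ 1)" "\<Phi> $ 1 \<noteq> 0"
      using \<open>\<Phi> \<noteq> 0\<close> by (auto simp: vec_eq_iff forall_2)
    moreover have "(vector [1, - c / d] :: complex^2) $ 1 = 1" by simp
    ultimately show ?thesis by blast
  qed
  then obtain z v where \<Phi>: "\<Phi> = (\<chi> i. z $ i *s v)" and v: "v \<noteq> 0" and z: "z $ 1 = 1 \<or> z $ 2 = 1"
    by blast
  define n where "n = Re (herm v v)"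
  have n: "n \<noteq> 0"
    using v by (auto simp: n_def Re_herm vec_eq_iff forall_2 complex_eq_iff
        add_nonneg_eq_0_iff sum_squares_eq_zero_iff)
  \<comment> \<open>The system to solve is \<open>cnj (z$1) * w$2 + cnj (w$1) * z$2 = s\<close>,
    with \<open>p\<close> and \<open>q\<close> the real parts of \<open>cnj (z$1) * w$1\<close> and
    \<open>cnj (z$2) * w$2\<close>.\<close>
  define s where "s = Complex (\<delta> $ 1) (\<delta> $ 2) / of_real (2 * n)"
  have s: "2 * n * Re s = \<delta> $ 1" "2 * n * Im s = \<delta> $ 2"
    using n by (simp_all add: s_def)
  define p where "p = (\<delta> $ 0 + \<delta> $ 3) / (4 * n)"
  define q where "q = (\<delta> $ 0 - \<delta> $ 3) / (4 * n)"
  have pq: "\<delta> $ 0 = 2 * n * (p + q)" "\<delta> $ 3 = 2 * n * (p - q)"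
    using n by (simp_all add: p_def q_def field_simps)
  have orth: "Re (cnj (z$1) * z$1) * q + Re (cnj (z$2) * z$2) * p = Re (cnj (cnj (z$1) * z$2) * s)"
  proof -
    have "mdot (rvec \<Phi>) \<delta> = 4 * n * n *
        (Re (cnj (z$1) * z$1) * q + Re (cnj (z$2) * z$2) * p - Re (cnj (cnj (z$1) * z$2) * s))"
      unfolding \<Phi> pq s[symmetric] mdot_def
      by (simp add: rvec_eq_rform rform_collinear n_def[symmetric]) (simp add: algebra_simps)
    then show ?thesis using n \<delta> by simp
  qed
  \<comment> \<open>The variation of the doublet with coefficient 1 is taken real, which fixes the
    common phase. The off-diagonal equation gives the other entry, and \<open>orth\<close> is the
    remaining diagonal equation.\<close>
  define w :: "complex^2" where
    "w = (if z $ 1 = 1 then vector [of_real p, s - of_real p * z $ 2]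
          else vector [cnj s - of_real q * z $ 1, of_real q])"
  define h where "h = (\<chi> i. w $ i *s v)"
  have "rform \<Phi> h = \<delta>"
  proof (cases "z $ 1 = 1")
    case True
    then have q: "q = Re (cnj (z$2) * s) - Re (cnj (z$2) * z$2) * p"
      using orth by (simp add: algebra_simps)
    show ?thesis
      unfolding \<Phi> h_def vec4_eq_iff rform_collinear n_def[symmetric] pq s[symmetric]
      using True by (simp add: w_def q algebra_simps)
  next
    case False
    then have "z $ 2 = 1" using z by simp
    then have p: "p = Re (z$1 * s) - Re (cnj (z$1) * z$1) * q"
      using orth by (simp add: algebra_simps)
    show ?thesis
      unfolding \<Phi> h_def vec4_eq_iff rform_collinear n_def[symmetric] pq s[symmetric]
      using False \<open>z $ 2 = 1\<close> by (simp add: w_def p algebra_simps)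
  qed
  moreover have "2 * mdot (rvec \<Phi>) (rvec h) = - mdot (rform \<Phi> h) (rform \<Phi> h)"
    unfolding \<Phi> h_def by (rule mdot_rform_collinear)
  ultimately show thesis using that by metis
qed

lemma herm_U2:
  assumes "W \<in> U2"
  shows "herm (W *v x) (W *v y) = herm x y"
proof -
  have W: "cnj (W$1$i) * W$1$j + cnj (W$2$i) * W$2$j = (if i = j then 1 else 0)" for i j
  proof -
    have "(dagger W ** W) $ i $ j = mat 1 $ i $ j"
      using assms by (simp add: U2_def)
    then show ?thesis by (simp add: dagger_def matrix_matrix_mult_def mat_def sum_2)
  qed
  have "herm (W *v x) (W *v y) =
     (\<Sum>i\<in>UNIV. \<Sum>j\<in>UNIV. cnj (x$i) * y$j * (cnj (W$1$i) * W$1$j + cnj (W$2$i) * W$2$j))"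
    by (simp add: herm_def matrix_vector_mult_def sum_2 algebra_simps)
  also have "\<dots> = herm x y"
    unfolding W by (simp add: herm_def sum_2)
  finally show ?thesis .
qed

text \<open>The bilinears are constant on the electroweak orbit. Thus a variation that moves them to
  first order is not a Goldstone direction.\<close>

lemma rform_orbit_tangent_eq_0:
  assumes "v \<in> orbit_tangent_space \<Phi>"
  shows "rform \<Phi> v = 0"
proof -
  obtain \<gamma> where \<gamma>: "\<gamma> 0 = \<Phi>" "\<And>t. \<gamma> t \<in> electroweak_orbit \<Phi>" "(\<gamma> has_vector_derivative v) (at 0)"
    using assms by (auto simp: orbit_tangent_space_def)
  have "rvec (\<gamma> t) = rvec \<Phi>" for t
    using \<gamma>(2)[of t] by (auto simp: electroweak_orbit_def rvec_def herm_U2)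
  moreover have "((\<lambda>t. rvec (\<gamma> t)) has_derivative (\<lambda>t. rform \<Phi> (t *\<^sub>R v))) (at 0)"
    using \<gamma>(3) unfolding has_vector_derivative_def
    by (rule has_derivative_compose) (simp add: \<gamma>(1) rvec_has_derivative)
  ultimately have "((\<lambda>t::real. rvec \<Phi>) has_derivative (\<lambda>t. rform \<Phi> (t *\<^sub>R v))) (at 0)"
    by simp
  then have "(\<lambda>t. rform \<Phi> (t *\<^sub>R v)) = (\<lambda>t::real. 0)"
    by (rule has_derivative_unique) simp
  from fun_cong[OF this, of 1] show ?thesis by simp
qed

subsection \<open>Derivatives of the potential\<close>

text \<open>The gradient of the potential with respect to the bilinears.\<close>

definition rgrad :: "real^4 \<Rightarrow> real^4^4 \<Rightarrow> config \<Rightarrow> real^4" where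
  "rgrad M \<Lambda> \<Phi> = lower_tensor \<Lambda> *v rvec \<Phi> - lower_vec M"

lemma lower_tensor_symmetric:
  assumes "transpose \<Lambda> = \<Lambda>"
  shows "x \<bullet> (lower_tensor \<Lambda> *v y) = (lower_tensor \<Lambda> *v x) \<bullet> y"
proof -
  have "transpose (lower_tensor \<Lambda>) = lower_tensor \<Lambda>"
    using assms by (simp add: lower_tensor_def matrix_transpose_mul transpose_minkowski matrix_mul_assoc)
  then show ?thesis by (metis inner_transpose_mult)
qed

lemma potential_has_derivative:
  assumes "transpose \<Lambda> = \<Lambda>"
  shows "(potential M \<Lambda> has_derivative (\<lambda>h. rgrad M \<Lambda> \<Phi> \<bullet> rform \<Phi> h)) (at \<Phi>)"
proof -
  have A: "((\<lambda>\<Phi>. lower_tensor \<Lambda> *v rvec \<Phi>) has_derivative (\<lambda>h. lower_tensor \<Lambda> *v rform \<Phi> h)) (at \<Phi>)"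
    by (rule bounded_linear.has_derivative[OF matrix_vector_mul_bounded_linear rvec_has_derivative])
  have "(potential M \<Lambda> has_derivative (\<lambda>h. - (lower_vec M \<bullet> rform \<Phi> h) + 1/2 *
      (rvec \<Phi> \<bullet> (lower_tensor \<Lambda> *v rform \<Phi> h) + rform \<Phi> h \<bullet> (lower_tensor \<Lambda> *v rvec \<Phi>)))) (at \<Phi>)"
    unfolding potential_def[abs_def]
    by (intro has_derivative_add has_derivative_minus has_derivative_inner_right
        has_derivative_mult_right has_derivative_inner rvec_has_derivative A)
  moreover have "- (lower_vec M \<bullet> rform \<Phi> h) + 1/2 *
      (rvec \<Phi> \<bullet> (lower_tensor \<Lambda> *v rform \<Phi> h) + rform \<Phi> h \<bullet> (lower_tensor \<Lambda> *v rvec \<Phi>)) =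
      rgrad M \<Lambda> \<Phi> \<bullet> rform \<Phi> h" for h
    by (simp add: rgrad_def inner_diff_left lower_tensor_symmetric[OF assms, of "rvec \<Phi>"]
        inner_commute[of "rform \<Phi> h"])
  ultimately show ?thesis by simp
qed

text \<open>Product rule: the curvature in bilinear space, plus the gradient paired with the
  constant second derivative \<open>rform h k\<close> of \<open>rvec\<close>.\<close>

lemma hessian_potential:
  assumes "transpose \<Lambda> = \<Lambda>"
  shows "hessian (potential M \<Lambda>) \<Phi> h k =
    (lower_tensor \<Lambda> *v rform \<Phi> k) \<bullet> rform \<Phi> h + rgrad M \<Lambda> \<Phi> \<bullet> rform h k"
proof -
  have "frechet_derivative (potential M \<Lambda>) (at \<Psi>) = (\<lambda>h. rgrad M \<Lambda> \<Psi> \<bullet> rform \<Psi> h)" for \<Psi>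
    by (rule frechet_derivative_at[OF potential_has_derivative[OF assms], symmetric])
  then have "hessian (potential M \<Lambda>) \<Phi> h k =
      frechet_derivative (\<lambda>\<Psi>. rgrad M \<Lambda> \<Psi> \<bullet> rform \<Psi> h) (at \<Phi>) k"
    by (simp add: hessian_def)
  also have "((\<lambda>\<Psi>. rgrad M \<Lambda> \<Psi> \<bullet> rform \<Psi> h) has_derivative
      (\<lambda>k. rgrad M \<Lambda> \<Phi> \<bullet> rform k h + (lower_tensor \<Lambda> *v rform \<Phi> k - 0) \<bullet> rform \<Phi> h)) (at \<Phi>)"
    unfolding rgrad_def[abs_def]
    by (intro has_derivative_inner has_derivative_diff has_derivative_const
        bounded_linear.has_derivative[OF matrix_vector_mul_bounded_linear rvec_has_derivative]
        bounded_linear_imp_has_derivative rform.bounded_linear_left)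
  then have "frechet_derivative (\<lambda>\<Psi>. rgrad M \<Lambda> \<Psi> \<bullet> rform \<Psi> h) (at \<Phi>) =
      (\<lambda>k. rgrad M \<Lambda> \<Phi> \<bullet> rform k h + (lower_tensor \<Lambda> *v rform \<Phi> k - 0) \<bullet> rform \<Phi> h)"
    by (rule frechet_derivative_at[symmetric])
  finally show ?thesis by (simp add: rform_commute[of h])
qed

text \<open>A null vector of a positive semidefinite symmetric form lies in its radical.\<close>

lemma hessian_kernel:
  assumes sym: "transpose \<Lambda> = \<Lambda>"
    and psd: "\<And>h. hessian (potential M \<Lambda>) \<Phi> h h \<ge> 0"
    and "hessian (potential M \<Lambda>) \<Phi> h h = 0"
  shows "hessian (potential M \<Lambda>) \<Phi> h k = 0"
proof -
  define B where "B = hessian (potential M \<Lambda>) \<Phi>"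
  have "(lower_tensor \<Lambda> *v rform \<Phi> h) \<bullet> rform \<Phi> k = (lower_tensor \<Lambda> *v rform \<Phi> k) \<bullet> rform \<Phi> h"
    by (metis lower_tensor_symmetric[OF sym] inner_commute)
  then have expand: "B (h + t *\<^sub>R k) (h + t *\<^sub>R k) = B h h + 2 * t * B h k + t^2 * B k k" for t
    by (simp add: B_def hessian_potential[OF sym] rform.add_left rform.add_right rform.scaleR_left
        rform.scaleR_right matrix_vector_right_distrib matrix_vector_mult_scaleR inner_add_left
        inner_add_right rform_commute[of k h]) (simp add: power2_eq_square algebra_simps)
  let ?b = "B h k" and ?c = "B k k"
  have c: "?c \<ge> 0" and hh: "B h h = 0"
    using psd assms(3) by (simp_all add: B_def)
  have "0 \<le> B (h + (- ?b / (?c + 1)) *\<^sub>R k) (h + (- ?b / (?c + 1)) *\<^sub>R k)"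
    using psd by (simp add: B_def)
  \<comment> \<open>The denominator \<open>?c + 1\<close> of the step length stays positive even
    when \<open>?c\<close> is zero.\<close>
  also have "\<dots> = - (?b^2 * (?c + 2)) / (?c + 1)^2"
    using c unfolding expand hh by (simp add: divide_simps) (simp add: algebra_simps power2_eq_square)
  finally have "?b^2 * (?c + 2) \<le> 0"
    using c by (simp add: divide_simps)
  then show ?thesis
    using c by (simp add: B_def mult_le_0_iff)
qed

subsection \<open>Reality of the coefficients\<close>

lemma rvec_eq_herm:
  "complex_of_real (rvec \<Phi> $ 0) = herm (\<Phi> $ 1) (\<Phi> $ 1) + herm (\<Phi> $ 2) (\<Phi> $ 2)"
  "complex_of_real (rvec \<Phi> $ 1) = herm (\<Phi> $ 1) (\<Phi> $ 2) + herm (\<Phi> $ 2) (\<Phi> $ 1)"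
  "complex_of_real (rvec \<Phi> $ 2) = - \<i> * (herm (\<Phi> $ 1) (\<Phi> $ 2) - herm (\<Phi> $ 2) (\<Phi> $ 1))"
  "complex_of_real (rvec \<Phi> $ 3) = herm (\<Phi> $ 1) (\<Phi> $ 1) - herm (\<Phi> $ 2) (\<Phi> $ 2)"
  by (simp_all add: complex_eq_iff rvec_def Re_herm Im_herm)

lemma real_coefficients_potential:
  assumes M: "M $ 2 = 0" and \<Lambda>: "\<And>\<mu>. \<mu> \<noteq> 2 \<Longrightarrow> \<Lambda> $ \<mu> $ 2 = 0 \<and> \<Lambda> $ 2 $ \<mu> = 0"
  shows "real_coefficients (potential M \<Lambda>)"
proof -
  \<comment> \<open>These are the coefficients of the four bilinears in the products of doublets.
    The array \<open>s2\<close> omits the factor \<open>- \<i>\<close>; as the second bilinear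
    enters only squared, this leaves a real minus sign in \<open>c\<close>.\<close>
  define s0 :: "2 \<Rightarrow> 2 \<Rightarrow> real" where "s0 i j = (if i = j then 1 else 0)" for i j
  define s1 :: "2 \<Rightarrow> 2 \<Rightarrow> real" where "s1 i j = (if i = j then 0 else 1)" for i j
  define s2 :: "2 \<Rightarrow> 2 \<Rightarrow> real" where "s2 i j = (if i = j then 0 else if i = 1 then 1 else -1)" for i j
  define s3 :: "2 \<Rightarrow> 2 \<Rightarrow> real" where "s3 i j = (if i \<noteq> j then 0 else if i = 1 then 1 else -1)" for i j
  define b where "b i j = - M$0 * s0 i j + M$1 * s1 i j + M$3 * s3 i j" for i j
  define c where "c i j k l = (\<Lambda>$0$0 * s0 i j * s0 k l + \<Lambda>$1$1 * s1 i j * s1 k l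
    - \<Lambda>$2$2 * s2 i j * s2 k l + \<Lambda>$3$3 * s3 i j * s3 k l
    - (\<Lambda>$0$1 + \<Lambda>$1$0) * s0 i j * s1 k l - (\<Lambda>$0$3 + \<Lambda>$3$0) * s0 i j * s3 k l
    + (\<Lambda>$1$3 + \<Lambda>$3$1) * s1 i j * s3 k l) / 2" for i j k l
  have "complex_of_real (potential M \<Lambda> \<Phi>) =
      (\<Sum>i\<in>UNIV. \<Sum>j\<in>UNIV. of_real (b i j) * herm (\<Phi> $ i) (\<Phi> $ j)) +
      (\<Sum>i\<in>UNIV. \<Sum>j\<in>UNIV. \<Sum>k\<in>UNIV. \<Sum>l\<in>UNIV.
         of_real (c i j k l) * (herm (\<Phi> $ i) (\<Phi> $ j) * herm (\<Phi> $ k) (\<Phi> $ l)))" for \<Phi>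
  proof -
    let ?r = "\<lambda>\<mu>. rvec \<Phi> $ \<mu>"
    have z: "\<Lambda>$0$2 = 0" "\<Lambda>$2$0 = 0" "\<Lambda>$1$2 = 0" "\<Lambda>$2$1 = 0" "\<Lambda>$3$2 = 0" "\<Lambda>$2$3 = 0"
      using \<Lambda>[of 0] \<Lambda>[of 1] \<Lambda>[of 3] by simp_all
    have "potential M \<Lambda> \<Phi> = - M$0 * ?r 0 + M$1 * ?r 1 + M$3 * ?r 3
      + (\<Lambda>$0$0 * (?r 0 * ?r 0) + \<Lambda>$1$1 * (?r 1 * ?r 1) + \<Lambda>$2$2 * (?r 2 * ?r 2) + \<Lambda>$3$3 * (?r 3 * ?r 3)
      - (\<Lambda>$0$1 + \<Lambda>$1$0) * (?r 0 * ?r 1) - (\<Lambda>$0$3 + \<Lambda>$3$0) * (?r 0 * ?r 3)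
      + (\<Lambda>$1$3 + \<Lambda>$3$1) * (?r 1 * ?r 3)) / 2"
      unfolding potential_def lower_vec_def lower_tensor_mult_vec minkowski_inner inner_minkowski
      by (simp add: mdot_def matrix_vector_mult_def[of \<Lambda>] sum_index4 minkowski_mult_vec_nth M z)
         (simp add: field_simps)
    then show ?thesis
      by (simp add: rvec_eq_herm sum_2 b_def c_def s0_def s1_def s2_def s3_def) (simp add: field_simps)
  qed
  then show ?thesis
    unfolding real_coefficients_def by blast
qed

subsection \<open>The distinguished direction\<close>

lemma lower_tensor_nth:
  "lower_tensor \<Lambda> $ i $ j = (if i = 0 then 1 else -1) * (if j = 0 then 1 else -1) * \<Lambda> $ i $ j"
proof -
  let ?\<epsilon> = "if j = 0 then 1 else -1 :: real"
  have g: "minkowski *v axis j 1 = ?\<epsilon> *\<^sub>R axis j 1"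
    by (simp only: vec_eq_iff minkowski_mult_vec_nth) (simp add: axis_def)
  have "lower_tensor \<Lambda> *v axis j 1 = ?\<epsilon> *\<^sub>R (minkowski *v (\<Lambda> *v axis j 1))"
    by (simp only: lower_tensor_mult_vec g matrix_vector_mult_scaleR)
  then have "(lower_tensor \<Lambda> *v axis j 1) $ i = ?\<epsilon> * (minkowski *v (\<Lambda> *v axis j 1)) $ i"
    by simp
  then show ?thesis
    unfolding minkowski_mult_vec_nth by (simp add: matrix_vector_mult_basis column_def)
qed

definition spatial_embed :: "real^3 \<Rightarrow> real^4" where
  "spatial_embed e = (\<chi> \<mu>. if \<mu> = 0 then 0 else if \<mu> = 1 then e $ 1 else if \<mu> = 2 then e $ 2 else e $ 3)"

text \<open>Orthogonality to the mixed row makes the time component of the image vanish, and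
  lowering both spatial indices leaves the block unchanged.\<close>

lemma CP_eigenvector_embed:
  assumes "transpose \<Lambda> = \<Lambda>" "CP_eigenvector M \<Lambda> e"
  obtains l where "\<Lambda> *v spatial_embed e = l *\<^sub>R spatial_embed e" "mdot M (spatial_embed e) = 0"
    "e \<noteq> 0"
proof -
  obtain l where l: "spatial_block (lower_tensor \<Lambda>) *v e = l *\<^sub>R e" and "e \<noteq> 0"
    and orth: "orthogonal e (spatial_vec (lower_tensor \<Lambda> $ 0))"
      "orthogonal e (spatial_vec (lower_vec M))"
    using assms(2) by (auto simp: CP_eigenvector_def eigenvector_def)
  have "\<Lambda> *v spatial_embed e = l *\<^sub>R spatial_embed e"
    using l orth(1)
    by (simp add: vec4_eq_iff vec_eq_iff forall_3 matrix_vector_mult_def sum_3 sum_index4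
        spatial_block_def spatial_vec_def spatial_index_def spatial_embed_def lower_tensor_nth
        orthogonal_def inner_vec_def algebra_simps)
  moreover have "mdot M (spatial_embed e) = 0"
    using orth(2)
    by (simp add: mdot_def spatial_vec_def spatial_index_def spatial_embed_def lower_vec_def
        minkowski_mult_vec_nth orthogonal_def inner_vec_def sum_3 algebra_simps)
  ultimately show thesis using that \<open>e \<noteq> 0\<close> by blast
qed

text \<open>The eigenvector equation and the orthogonality to \<open>M\<close> are Lorentz
  covariant, so after the rotation they hold for the second axis itself.\<close>

lemma rotated_distinguished_axis:
  assumes sym: "transpose \<Lambda> = \<Lambda>" and CP: "CP_eigenvector M \<Lambda> e"
    and U: "U \<in> SU2" "induces U R" and s: "spatial_block R *v e = s *\<^sub>R axis 2 1"
  shows "(R *v M) $ 2 = 0"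
    and "\<mu> \<noteq> 2 \<Longrightarrow> transform_tensor R \<Lambda> $ \<mu> $ 2 = 0 \<and> transform_tensor R \<Lambda> $ 2 $ \<mu> = 0"
proof -
  let ?x = "spatial_embed e" and ?a = "axis 2 1 :: real^4"
  obtain l where l: "\<Lambda> *v ?x = l *\<^sub>R ?x" "mdot M ?x = 0" "e \<noteq> 0"
    using CP_eigenvector_embed[OF sym CP] .
  have R: "lorentz R" by (rule induces_lorentz[OF U])
  have "(R *v ?x) $ 0 = 0"
    using induces_U2_time_component[of U R ?x] U by (simp add: SU2_def spatial_embed_def)
  moreover have "(R *v ?x) $ spatial_index i = (spatial_block R *v e) $ i" for i
    by (simp add: matrix_vector_mult_def sum_3 sum_index4 spatial_block_def spatial_index_def
        spatial_embed_def)
  from this[of 1] this[of 2] this[of 3]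
  have "(R *v ?x) $ 1 = 0" "(R *v ?x) $ 2 = s" "(R *v ?x) $ 3 = 0"
    unfolding s by (simp_all add: spatial_index_def axis_def)
  ultimately have Rx: "R *v ?x = s *\<^sub>R ?a"
    by (simp add: vec4_eq_iff axis_def)
  have "mdot (R *v ?x) (R *v ?x) = mdot ?x ?x"
    using R by (simp add: lorentz_def)
  \<comment> \<open>The isometry property keeps the length of \<open>e\<close>, which lets
    \<open>s\<close> be cancelled below.\<close>
  then have "s * s = e$1 * e$1 + e$2 * e$2 + e$3 * e$3"
    unfolding Rx by (simp add: mdot_def spatial_embed_def axis_def)
  also have "\<dots> = e \<bullet> e" by (simp add: inner_vec_def sum_3)
  finally have "s \<noteq> 0" using l(3) by auto
  have "mdot (R *v M) (R *v ?x) = 0"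
    using R l(2) by (simp add: lorentz_def)
  then show "(R *v M) $ 2 = 0"
    unfolding Rx using \<open>s \<noteq> 0\<close> by (simp add: mdot_def axis_def)
  have "minkowski *v ?x = - ?x" "minkowski *v ?a = - ?a"
    by (simp_all add: vec4_eq_iff minkowski_mult_vec_nth spatial_embed_def axis_def)
  then have "s *\<^sub>R (transform_tensor R \<Lambda> *v ?a) = s *\<^sub>R (l *\<^sub>R ?a)"
    using transform_tensor_minkowski[OF R, of \<Lambda> ?x] unfolding Rx
    by (simp add: l(1) Rx matrix_vector_mult_scaleR vec.neg mult.commute)
  then have *: "transform_tensor R \<Lambda> *v ?a = l *\<^sub>R ?a"
    by (rule scaleR_left_imp_eq[OF \<open>s \<noteq> 0\<close>])
  have "transpose (transform_tensor R \<Lambda>) = transform_tensor R \<Lambda>"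
    using sym by (simp add: transform_tensor_def matrix_transpose_mul matrix_mul_assoc)
  from arg_cong[OF this, of "\<lambda>T. T $ \<mu> $ 2"]
  have "transform_tensor R \<Lambda> $ 2 $ \<mu> = transform_tensor R \<Lambda> $ \<mu> $ 2"
    by (simp add: transpose_def)
  moreover have "transform_tensor R \<Lambda> $ \<mu> $ 2 = (l *\<^sub>R ?a) $ \<mu>"
    unfolding *[symmetric] by (simp add: matrix_vector_mult_basis column_def)
  ultimately show "transform_tensor R \<Lambda> $ \<mu> $ 2 = 0 \<and> transform_tensor R \<Lambda> $ 2 $ \<mu> = 0" if "\<mu> \<noteq> 2"
    using that by (simp add: axis_def)
qed

lemma parallel_if_annihilates_orthogonal:
  fixes u X :: "'a::real_inner"
  assumes "\<And>\<delta>. u \<bullet> \<delta> = 0 \<Longrightarrow> X \<bullet> \<delta> = 0"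
  obtains k where "X = k *\<^sub>R u"
proof -
  \<comment> \<open>Orthogonal projection onto \<open>u\<close>; for \<open>u = 0\<close> the
    quotient is 0 and \<open>\<delta>\<close> is \<open>X\<close>.\<close>
  define k where "k = (X \<bullet> u) / (u \<bullet> u)"
  define \<delta> where "\<delta> = X - k *\<^sub>R u"
  have u: "u \<bullet> \<delta> = 0"
    by (simp add: \<delta>_def k_def inner_diff_right inner_commute)
  then have "\<delta> \<bullet> \<delta> = 0"
    using assms[OF u] by (simp add: \<delta>_def inner_diff_left)
  then show thesis using that[of k] by (simp add: \<delta>_def)
qed

section \<open>The minimum in the prototypical frame\<close>

theorem mainTheorem10:
  fixes M :: "real^4" and \<Lambda> :: "real^4^4" and e :: "real^3" and \<Phi> :: config
    and \<Lambda>0 \<Lambda>1 \<Lambda>2 \<Lambda>3 :: real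
  assumes "transpose \<Lambda> = \<Lambda>"
    and "positivity \<Lambda>"
    and "CP_eigenvector M \<Lambda> e"
    and "\<And>e'. CP_eigenvector M \<Lambda> e' \<Longrightarrow> \<exists>c. e' = c *\<^sub>R e"
    and "prototypical_form \<Lambda> e \<Lambda>0 \<Lambda>1 \<Lambda>2 \<Lambda>3"
    and "spontaneously_CP_violating M \<Lambda> \<Phi>"
    and "is_minimum (potential M \<Lambda>) \<Phi>"
  shows "\<Lambda>2 > \<Lambda>1 \<and> \<Lambda>2 > \<Lambda>3"
proof -
  note sym = assms(1)
  obtain U R L s where U: "U \<in> SU2" "induces U R" and s: "spatial_block R *v e = s *\<^sub>R axis 2 1"
    and L: "proper_orthochronous L" "acts_only_on_013 L"
    and D: "transform_tensor L (transform_tensor R \<Lambda>) = diag4 \<Lambda>0 (-\<Lambda>1) (-\<Lambda>2) (-\<Lambda>3)"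
    using assms(5) unfolding prototypical_form_def by blast
  note axis = rotated_distinguished_axis[OF sym assms(3) U s]
  have "real_coefficients (potential (R *v M) (transform_tensor R \<Lambda>))"
    by (rule real_coefficients_potential[OF axis])
  \<comment> \<open>Otherwise \<open>U\<close> would be a reparametrization excluded by spontaneous
    violation.\<close>
  then have "Im (herm (reparam U \<Phi> $ 1) (reparam U \<Phi> $ 2)) \<noteq> 0"
    using assms(6) U unfolding spontaneously_CP_violating_def by blast
  then have r2: "(R *v rvec \<Phi>) $ 2 \<noteq> 0"
    using U(2)[unfolded induces_def, rule_format, of \<Phi>, symmetric] by (simp add: rvec_def[of "reparam U \<Phi>"])

  define A where "A = L ** R"
  have A: "lorentz A"
    using induces_lorentz[OF U] L(1)
    by (auto simp: A_def proper_orthochronous_def lorentz_iff[of L] intro: lorentz_mult)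
  \<comment> \<open>The diagonalizing boost fixes the second coordinate, so both facts about it
    survive the passage from \<open>R\<close> to \<open>A\<close>.\<close>
  have L2: "(L *v x) $ 2 = x $ 2" for x
    using L(2) by (simp add: acts_only_on_013_def matrix_vector_mult_def sum_index4)
  define r where "r = A *v rvec \<Phi>"
  have r: "r $ 2 \<noteq> 0" and AM: "(A *v M) $ 2 = 0"
    using r2 axis(1) by (simp_all add: r_def A_def matrix_vector_mul_assoc[symmetric] L2)
  have "transform_tensor A \<Lambda> = diag4 \<Lambda>0 (-\<Lambda>1) (-\<Lambda>2) (-\<Lambda>3)"
    using D by (simp add: transform_tensor_def A_def matrix_transpose_mul matrix_mul_assoc)
  then have A\<Lambda>: "A *v (\<Lambda> *v (minkowski *v x)) =
      diag4 \<Lambda>0 (-\<Lambda>1) (-\<Lambda>2) (-\<Lambda>3) *v (minkowski *v (A *v x))" for x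
    using transform_tensor_minkowski[OF A, of \<Lambda> x] by simp

  have "neutral_stationary_point (potential M \<Lambda>) \<Phi>"
    using assms(6) by (simp add: spontaneously_CP_violating_def)
  then obtain c d where "\<Phi> \<noteq> 0" and cd: "(c, d) \<noteq> (0, 0)" "c *s (\<Phi> $ 1) + d *s (\<Phi> $ 2) = 0"
    and stat: "stationary (potential M \<Lambda>) \<Phi>"
    unfolding neutral_stationary_point_def by blast
  have neutral: "\<exists>h. rform \<Phi> h = \<delta> \<and> 2 * mdot (rvec \<Phi>) (rvec h) = - mdot \<delta> \<delta>"
    if "mdot (rvec \<Phi>) \<delta> = 0" for \<delta>
    by (rule rform_surj_neutral[OF \<open>\<Phi> \<noteq> 0\<close> cd that]) blast
  have grad_0: "rgrad M \<Lambda> \<Phi> \<bullet> rform \<Phi> h = 0" for h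
    using has_derivative_unique[OF potential_has_derivative[OF sym] stat[unfolded stationary_def]]
    by (rule fun_cong)
  \<comment> \<open>Lagrange condition on the light cone: the gradient kills all its tangent
    vectors, and \<open>k\<close> is the multiplier.\<close>
  have "rgrad M \<Lambda> \<Phi> \<bullet> \<delta> = 0" if \<delta>: "(minkowski *v rvec \<Phi>) \<bullet> \<delta> = 0" for \<delta>
  proof -
    obtain h where "rform \<Phi> h = \<delta>"
      using neutral \<delta> unfolding minkowski_inner by blast
    then show ?thesis using grad_0[of h] by simp
  qed
  then obtain k where k: "rgrad M \<Lambda> \<Phi> = k *\<^sub>R (minkowski *v rvec \<Phi>)"
    using parallel_if_annihilates_orthogonal by blast

  have "minkowski *v rgrad M \<Lambda> \<Phi> = \<Lambda> *v (minkowski *v rvec \<Phi>) - M"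
    by (simp add: rgrad_def lower_tensor_mult_vec lower_vec_def matrix_vector_mult_diff_distrib
        minkowski_minkowski_vec)
  then have "\<Lambda> *v (minkowski *v rvec \<Phi>) - M = k *\<^sub>R rvec \<Phi>"
    by (simp add: k matrix_vector_mult_scaleR minkowski_minkowski_vec)
  then have "A *v (\<Lambda> *v (minkowski *v rvec \<Phi>) - M) = k *\<^sub>R r"
    by (simp add: matrix_vector_mult_scaleR r_def)
  then have "(diag4 \<Lambda>0 (-\<Lambda>1) (-\<Lambda>2) (-\<Lambda>3) *v (minkowski *v r) - A *v M) $ 2 = k * r $ 2"
    by (simp add: matrix_vector_mult_diff_distrib A\<Lambda> r_def)
  then have k_eq: "k = \<Lambda>2"
    using r AM by (simp add: diag4_mult_vec_nth minkowski_mult_vec_nth)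

  have psd: "hessian (potential M \<Lambda>) \<Phi> h h \<ge> 0" for h
    using assms(7) by (simp add: is_minimum_def)
  have pos: "(\<Lambda>0 - \<Lambda>2) * (y$0)^2 + (\<Lambda>2 - \<Lambda>1) * (y$1)^2 + (\<Lambda>2 - \<Lambda>3) * (y$3)^2 > 0"
    (is "?Q > 0") if y: "mdot r y = 0" "y \<noteq> 0" for y
  proof -
    obtain \<delta> where \<delta>: "A *v \<delta> = y" using lorentz_surj[OF A] .
    have mdot_A: "mdot u w = mdot (A *v u) (A *v w)" for u w
      using A by (simp add: lorentz_def)
    have "mdot (rvec \<Phi>) \<delta> = 0"
      using y(1) by (simp add: mdot_A[of "rvec \<Phi>"] \<delta> r_def)
    then obtain h where h: "rform \<Phi> h = \<delta>" "2 * mdot (rvec \<Phi>) (rvec h) = - mdot \<delta> \<delta>"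
      using neutral by blast
    have "hessian (potential M \<Lambda>) \<Phi> h h = mdot \<delta> (\<Lambda> *v (minkowski *v \<delta>)) + k * (2 * mdot (rvec \<Phi>) (rvec h))"
      unfolding mdot_commute[of \<delta>]
      by (simp add: hessian_potential[OF sym] h(1) k rform_self lower_tensor_mult_vec minkowski_inner)
    \<comment> \<open>The second-order term becomes the multiplier times the Minkowski square; with
      \<open>k = \<Lambda>2\<close> the \<open>y$2\<close> contribution then cancels.\<close>
    also have "\<dots> = mdot y (diag4 \<Lambda>0 (-\<Lambda>1) (-\<Lambda>2) (-\<Lambda>3) *v (minkowski *v y)) - \<Lambda>2 * mdot y y"
      unfolding h(2) k_eq mdot_A[of \<delta>] A\<Lambda> \<delta> by simp
    also have "\<dots> = ?Q"
      by (simp add: mdot_def diag4_mult_vec_nth minkowski_mult_vec_nth power2_eq_square algebra_simps)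
    finally have Q: "hessian (potential M \<Lambda>) \<Phi> h h = ?Q" .
    have "?Q \<noteq> 0"
    proof
      assume "?Q = 0"
      then have "\<forall>w. hessian (potential M \<Lambda>) \<Phi> h w = 0"
        using hessian_kernel[OF sym psd] Q by simp
      then have "h \<in> orbit_tangent_space \<Phi>"
        using assms(7) unfolding is_minimum_def by blast
      then have "\<delta> = 0"
        using h(1) rform_orbit_tangent_eq_0 by simp
      then show False using \<delta> y(2) by simp
    qed
    then show ?thesis using psd[of h] Q by linarith
  qed
  have "\<Lambda>2 - \<Lambda>1 > 0"
    \<comment> \<open>The multiple of the second axis makes the test vector Minkowski-orthogonal to
      \<open>r\<close> and costs nothing in \<open>?Q\<close>.\<close>
    using pos[of "axis 1 1 - (r$1 / r$2) *\<^sub>R axis 2 1"] r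
    by (simp add: mdot_def axis_def vec4_eq_iff)
  moreover have "\<Lambda>2 - \<Lambda>3 > 0"
    using pos[of "axis 3 1 - (r$3 / r$2) *\<^sub>R axis 2 1"] r
    by (simp add: mdot_def axis_def vec4_eq_iff)
  ultimately show ?thesis by simp
qed

end
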